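(* Let $Q(x,y)\in\mathbb{R}[x,y]$ and let $\mathcal{S}_E(Q)$ be the set of all regular tubular surfaces in Euclidean $3$-space whose Gaussian curvature $K$ and mean curvature $H$ satisfy $Q(K,H)\equiv 0$. Put $$Rad_E(Q)=\{r\in(0,+\infty)\,:\,Q(0,\tfrac{1}{2r})=0\},\qquad Rad_E^{*}(Q)=\{r\in Rad_E(Q)\,:\,Q(x,y)\in\langle xr^2-2ry+1\rangle\}.$$ Then the elements of $\mathcal{S}_E(Q)$ are exactly: (i) the right cylinders with radius in $Rad_E(Q)$; and (ii) the regular tubular surfaces with radius in $Rad_E^{*}(Q)$.
   Context: Let $\gamma:(a,b)\to\mathbb{E}^3$ be a smooth curve with nonzero tangent vectors (the central curve) and let $r>0$. The tubular surface of radius $r$ around $\gamma$ is the union of all circles of radius $r$ and center $\gamma(s)$ contained in the planes through $\gamma(s)$ normal to $\gamma'(s)$, $s\in(a,b)$; it is parametrized by the pairs $(s,v)$ with $v$ a unit vector orthogonal to $\gamma'(s)$, via $(s,v)\mapsto\gamma(s)+rv$. It is called regular if $\gamma$ is parametrized by arc length and $1-r\kappa(s)\cos t\neq0$ for all $(s,t)\in(a,b)\times\mathbb{R}$, where $\kappa=\|\gamma''\|$; the parametrization is then an immersion, and $K$ and $H$ are the Gaussian and mean curvatures of this immersed surface, where $H$ is half the sum of the principal curvatures, computed with the unit normal $-v$ at the point $(s,v)$ (pointing toward the central curve; so a cylinder of radius $r$ has $K=0$, $H=\frac1{2r}$). A right cylinder is a regular tubular surface with $\kappa\equiv0$. $\langle\varphi\rangle$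 denotes the ideal of $\mathbb{R}[x,y]$ generated by $\varphi$. *)

theory Defs
  imports "HOL-Analysis.Analysis" "HOL-Computational_Algebra.Polynomial"
begin

section \<open>Immersed surfaces in Euclidean 3-space and their curvatures\<close>

text \<open>
  A surface is given by a submanifold \<open>M\<close> of a normed space and maps \<open>f\<close> (the immersion) and
  \<open>N\<close> (a unit normal field along \<open>f\<close>), both differentiable on a neighbourhood of \<open>M\<close> in the
  ambient space. On tangent vectors \<open>d\<close> of \<open>M\<close> at \<open>p\<close>, the shape operator maps \<open>df d\<close> to
  \<open>- dN d\<close>. The principal curvatures are its eigenvalues.
\<close>

definition tangent_space :: "'a::real_normed_vector set \<Rightarrow> 'a \<Rightarrow> 'a set" where
  "tangent_space M p =
     {d. \<exists>c :: real \<Rightarrow> 'a. c 0 = p \<and> (\<forall>\<^sub>F t in nhds 0. c t \<in> M) \<and>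
           (c has_vector_derivative d) (at 0)}"

definition principal_curvatures ::
  "'a::real_normed_vector set \<Rightarrow> ('a \<Rightarrow> real^3) \<Rightarrow> ('a \<Rightarrow> real^3) \<Rightarrow> 'a \<Rightarrow> real \<Rightarrow> real \<Rightarrow> bool"
where
  "principal_curvatures M f N p k1 k2 \<longleftrightarrow>
     (let df = frechet_derivative f (at p); dN = frechet_derivative N (at p) in
      \<exists>d1 \<in> tangent_space M p. \<exists>d2 \<in> tangent_space M p.
        df d1 \<noteq> df d2 \<and> independent {df d1, df d2} \<and>
        - dN d1 = k1 *\<^sub>R df d1 \<and> - dN d2 = k2 *\<^sub>R df d2)"

text \<open>
  For an immersed surface the shape operator is self-adjoint, so a basis of principal
  directions exists and the unordered pair of principal curvatures is unique.
\<close>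

definition gaussian_curvature ::
  "'a::real_normed_vector set \<Rightarrow> ('a \<Rightarrow> real^3) \<Rightarrow> ('a \<Rightarrow> real^3) \<Rightarrow> 'a \<Rightarrow> real" where
  "gaussian_curvature M f N p =
     (THE K. \<exists>k1 k2. principal_curvatures M f N p k1 k2 \<and> K = k1 * k2)"

definition mean_curvature ::
  "'a::real_normed_vector set \<Rightarrow> ('a \<Rightarrow> real^3) \<Rightarrow> ('a \<Rightarrow> real^3) \<Rightarrow> 'a \<Rightarrow> real" where
  "mean_curvature M f N p =
     (THE H. \<exists>k1 k2. principal_curvatures M f N p k1 k2 \<and> H = (k1 + k2) / 2)"

section \<open>Tubular surfaces\<close>

definition vderiv :: "(real \<Rightarrow> 'a::real_normed_vector) \<Rightarrow> real \<Rightarrow> 'a" where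
  "vderiv \<gamma> s = vector_derivative \<gamma> (at s)"

text \<open>Infinitely differentiable; only used for open \<open>I\<close>.\<close>

definition smooth_curve_on :: "real set \<Rightarrow> (real \<Rightarrow> 'a::real_normed_vector) \<Rightarrow> bool" where
  "smooth_curve_on I \<gamma> \<longleftrightarrow> (\<forall>n. \<forall>s\<in>I. (vderiv ^^ n) \<gamma> differentiable (at s))"

text \<open>
  The data of a tubular surface: the end points of the parameter interval (possibly infinite),
  the central curve (only its restriction to the interval matters), and the radius.
\<close>

datatype tube = Tube (lower: ereal) (upper: ereal) (curve: "real \<Rightarrow> real^3") (radius: real)

definition interval :: "tube \<Rightarrow> real set" where
  "interval T = einterval (lower T) (upper T)"

definition tubular :: "tube \<Rightarrow> bool" where
  "tubular T \<longleftrightarrow> lower T < upper T \<and> 0 < radius T \<and> smooth_curve_on (interval T) (curve T) \<and>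
     (\<forall>s\<in>interval T. vderiv (curve T) s \<noteq> 0)"

definition curvature :: "tube \<Rightarrow> real \<Rightarrow> real" where
  "curvature T s = norm (vderiv (vderiv (curve T)) s)"

definition regular_tubular :: "tube \<Rightarrow> bool" where
  "regular_tubular T \<longleftrightarrow> tubular T \<and> (\<forall>s\<in>interval T. norm (vderiv (curve T) s) = 1) \<and>
     (\<forall>s\<in>interval T. \<forall>t. 1 - radius T * curvature T s * cos t \<noteq> 0)"

definition right_cylinder :: "tube \<Rightarrow> bool" where
  "right_cylinder T \<longleftrightarrow> regular_tubular T \<and> (\<forall>s\<in>interval T. curvature T s = 0)"

definition normal_bundle :: "tube \<Rightarrow> (real \<times> (real^3)) set" where
  "normal_bundle T = {(s, v). s \<in> interval T \<and> norm v = 1 \<and> v \<bullet> vderiv (curve T) s = 0}"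

definition tube_map :: "tube \<Rightarrow> real \<times> (real^3) \<Rightarrow> real^3" where
  "tube_map T = (\<lambda>(s, v). curve T s + radius T *\<^sub>R v)"

definition tube_normal :: "real \<times> (real^3) \<Rightarrow> real^3" where
  "tube_normal = (\<lambda>(s, v). - v)"

definition tube_points :: "tube \<Rightarrow> (real^3) set" where
  "tube_points T = (\<Union>s\<in>interval T. {x. dist (curve T s) x = radius T \<and>
     (x - curve T s) \<bullet> vderiv (curve T) s = 0})"

lemma tube_map_image:
  assumes "0 < radius T"
  shows "tube_map T ` normal_bundle T = tube_points T"
proof (intro equalityI subsetI)
  fix x assume "x \<in> tube_map T ` normal_bundle T"
  then obtain s v where sv: "s \<in> interval T" "norm v = 1" "v \<bullet> vderiv (curve T) s = 0"
      "x = curve T s + radius T *\<^sub>R v"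
    by (auto simp: tube_map_def normal_bundle_def)
  then have "dist (curve T s) x = radius T \<and> (x - curve T s) \<bullet> vderiv (curve T) s = 0"
    using assms by (simp add: dist_norm)
  with sv(1) show "x \<in> tube_points T"
    by (auto simp: tube_points_def)
next
  fix x assume "x \<in> tube_points T"
  then obtain s where s: "s \<in> interval T" "dist (curve T s) x = radius T"
      "(x - curve T s) \<bullet> vderiv (curve T) s = 0"
    by (auto simp: tube_points_def)
  define v where "v = (1 / radius T) *\<^sub>R (x - curve T s)"
  have "(s, v) \<in> normal_bundle T"
    using s assms by (simp add: normal_bundle_def v_def dist_norm norm_minus_commute)
  moreover have "x = tube_map T (s, v)"
    using assms by (simp add: tube_map_def v_def)
  ultimately show "x \<in> tube_map T ` normal_bundle T" by blast
qed

definition tube_K :: "tube \<Rightarrow> real \<times> (real^3) \<Rightarrow> real" where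
  "tube_K T = gaussian_curvature (normal_bundle T) (tube_map T) tube_normal"

definition tube_H :: "tube \<Rightarrow> real \<times> (real^3) \<Rightarrow> real" where
  "tube_H T = mean_curvature (normal_bundle T) (tube_map T) tube_normal"

section \<open>Bivariate polynomials\<close>

text \<open>
  \<open>\<real>[x,y]\<close> is represented as \<open>\<real>[x][y]\<close>: the outer variable is \<open>y\<close>, the coefficients are
  polynomials in \<open>x\<close>.
\<close>

definition var_x :: "real poly poly" where "var_x = [:[:0, 1:]:]"
definition var_y :: "real poly poly" where "var_y = [:0, 1:]"
definition const2 :: "real \<Rightarrow> real poly poly" where "const2 c = [:[:c:]:]"

definition eval2 :: "real poly poly \<Rightarrow> real \<Rightarrow> real \<Rightarrow> real" where
  "eval2 Q a b = poly (poly Q [:b:]) a"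

lemma eval2_simps [simp]:
  "eval2 var_x a b = a" "eval2 var_y a b = b" "eval2 (const2 c) a b = c"
  "eval2 0 a b = 0" "eval2 1 a b = 1"
  "eval2 (P + Q) a b = eval2 P a b + eval2 Q a b"
  "eval2 (P - Q) a b = eval2 P a b - eval2 Q a b"
  "eval2 (P * Q) a b = eval2 P a b * eval2 Q a b"
  by (simp_all add: eval2_def var_x_def var_y_def const2_def)

definition principal_ideal :: "'a::comm_ring_1 \<Rightarrow> 'a set" where
  "principal_ideal \<phi> = {p * \<phi> | p. True}"

section \<open>Tubular surfaces with a polynomial relation between the curvatures\<close>

definition S_E :: "real poly poly \<Rightarrow> tube set" where
  "S_E Q = {T. regular_tubular T \<and> (\<forall>p\<in>normal_bundle T. eval2 Q (tube_K T p) (tube_H T p) = 0)}"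

definition Rad_E :: "real poly poly \<Rightarrow> real set" where
  "Rad_E Q = {r. 0 < r \<and> eval2 Q 0 (1 / (2 * r)) = 0}"

definition Rad_E_star :: "real poly poly \<Rightarrow> real set" where
  "Rad_E_star Q = {r \<in> Rad_E Q.
     Q \<in> principal_ideal (var_x * const2 (r\<^sup>2) - const2 (2 * r) * var_y + 1)}"

end

theory Submission
  imports Defs "HOL-Analysis.Cross3"
begin

text \<open>
  Write \<open>c = \<langle>v, \<gamma>''(s)\<rangle>\<close>. Differentiating \<open>\<langle>v, \<gamma>'(s)\<rangle> = 0\<close> shows that the principal directions
  at \<open>(s, v)\<close> are \<open>\<gamma>'\<close> and \<open>v \<times> \<gamma>'\<close>, with principal curvatures \<open>- c / (1 - r c)\<close> and \<open>1 / r\<close>. So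
  \<open>(K, H)\<close> always lies on the line \<open>r\<^sup>2 x - 2 r y + 1 = 0\<close>. Where \<open>\<gamma>''\<close> vanishes, \<open>(K, H)\<close> is the
  point \<open>(0, 1 / (2 r))\<close>; where it does not, \<open>c\<close> runs over an interval as \<open>v\<close> turns, and \<open>(K, H)\<close>
  takes infinitely many values on the line. A polynomial vanishing at infinitely many points of
  a line is divisible by the equation of the line.
\<close>

section \<open>Linear algebra\<close>

text \<open>Two independent principal directions cannot lie on one line. The hypothesis keeps the
  set from collapsing to a singleton, which may well be independent.\<close>

lemma not_independent_collinear:
  fixes u :: "'a::real_vector"
  assumes "a *\<^sub>R u \<noteq> b *\<^sub>R u"
  shows "\<not> independent {a *\<^sub>R u, b *\<^sub>R u}"
proof
  assume ind: "independent {a *\<^sub>R u, b *\<^sub>R u}"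
  then have "b *\<^sub>R u \<noteq> 0"
    using dependent_zero[of "{a *\<^sub>R u, b *\<^sub>R u}"] by (metis insertCI)
  then have "a *\<^sub>R u = (a / b) *\<^sub>R (b *\<^sub>R u)"
    by simp
  moreover have "(a / b) *\<^sub>R (b *\<^sub>R u) \<in> span {b *\<^sub>R u}"
    by (rule span_scale, rule span_base) simp
  ultimately have "a *\<^sub>R u \<in> span {b *\<^sub>R u}"
    by metis
  moreover have "a *\<^sub>R u \<notin> span {b *\<^sub>R u}"
    using ind assms independent_insert[of "a *\<^sub>R u" "{b *\<^sub>R u}"] by (metis singletonD)
  ultimately show False
    by contradiction
qed

lemma norm_cross3_orthonormal:
  assumes "norm v = 1" "norm T = 1" "v \<bullet> T = 0"
  shows "norm (cross3 v T) = 1"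
proof -
  have "(norm (cross3 v T))\<^sup>2 = 1"
    using assms norm_cross[of v T] by simp
  then show ?thesis
    using norm_ge_zero[of "cross3 v T"] by (auto simp: power2_eq_1_iff)
qed

text \<open>With \<open>b = cross3 v T\<close>, Lagrange's formula for the triple product first
  gives \<open>cross3 w b = 0\<close>. Applied again to \<open>cross3 b (cross3 w b)\<close>, it
  turns this into \<open>(b \<bullet> b) *\<^sub>R w = (b \<bullet> w) *\<^sub>R b\<close>, where
  \<open>b\<close> is a unit vector.\<close>

lemma orthogonal_to_pair_collinear:
  fixes w v T :: "real^3"
  assumes "norm v = 1" "norm T = 1" "v \<bullet> T = 0" "w \<bullet> v = 0" "w \<bullet> T = 0"
  shows "w = (w \<bullet> cross3 v T) *\<^sub>R cross3 v T"
proof -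
  have bb: "cross3 v T \<bullet> cross3 v T = 1"
    using norm_cross3_orthonormal[OF assms(1-3)] by (simp add: dot_square_norm)
  have "cross3 w (cross3 v T) = 0"
    using assms Lagrange[of w v T] by simp
  then have "0 = (cross3 v T \<bullet> cross3 v T) *\<^sub>R w - (cross3 v T \<bullet> w) *\<^sub>R cross3 v T"
    using Lagrange[of "cross3 v T" w "cross3 v T"] by (simp add: scalar_mult_eq_scaleR)
  then show ?thesis
    using bb by (simp add: inner_commute)
qed

section \<open>Curvatures of a regular tube\<close>

context
  fixes T :: tube and s :: real
  assumes reg: "regular_tubular T" and s: "s \<in> interval T"
begin

private abbreviation (input) "\<gamma> \<equiv> curve T"
private abbreviation (input) "r \<equiv> radius T"
private abbreviation (input) "\<gamma>1 \<equiv> vderiv \<gamma>"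
private abbreviation (input) "\<gamma>2 \<equiv> vderiv \<gamma>1"

section \<open>The central curve: unit tangent and acceleration\<close>

lemma radius_pos: "0 < r"
  using reg by (simp add: regular_tubular_def tubular_def)

lemma eventually_interval: "eventually (\<lambda>t. t \<in> interval T) (nhds s)"
  using s by (intro eventually_nhds_in_open) (auto simp: interval_def)

lemma norm_tangent: "t \<in> interval T \<Longrightarrow> norm (\<gamma>1 t) = 1"
  using reg by (simp add: regular_tubular_def)

lemma curve_vderiv: "(\<gamma> has_vector_derivative \<gamma>1 s) (at s)"
proof -
  have "(vderiv ^^ 0) \<gamma> differentiable (at s)"
    using reg s by (simp only: regular_tubular_def tubular_def smooth_curve_on_def)
  then show ?thesis
    by (simp add: vderiv_def vector_derivative_works)
qed

lemma tangent_vderiv: "(\<gamma>1 has_vector_derivative \<gamma>2 s) (at s)"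
proof -
  have "(vderiv ^^ 1) \<gamma> differentiable (at s)"
    using reg s by (simp only: regular_tubular_def tubular_def smooth_curve_on_def)
  then show ?thesis
    using vector_derivative_works[of "vderiv \<gamma>" "at s"] by (simp add: vderiv_def)
qed

text \<open>The squared norm of the unit tangent is constant on the open interval, so its
  derivative, twice this inner product, vanishes.\<close>

lemma tangent_orthogonal_acceleration: "\<gamma>1 s \<bullet> \<gamma>2 s = 0"
proof -
  have "((\<lambda>t. \<gamma>1 t \<bullet> \<gamma>1 t) has_vector_derivative \<gamma>1 s \<bullet> \<gamma>2 s + \<gamma>2 s \<bullet> \<gamma>1 s) (at s)"
    using bounded_bilinear.has_vector_derivative[OF bounded_bilinear_inner tangent_vderiv tangent_vderiv] .
  moreover have "((\<lambda>t. \<gamma>1 t \<bullet> \<gamma>1 t) has_vector_derivative 0) (at s)"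
  proof (rule has_vector_derivative_transform_within_open[where f = "\<lambda>_. 1"])
    show "open (interval T)" by (simp add: interval_def)
    show "1 = \<gamma>1 t \<bullet> \<gamma>1 t" if "t \<in> interval T" for t
      using norm_tangent[OF that] by (simp add: dot_square_norm)
  qed (use s in auto)
  ultimately show ?thesis
    using vector_derivative_unique_at by (fastforce simp: inner_commute)
qed

section \<open>Differentials of the immersion and the normal; tangent vectors of the normal
  bundle\<close>

lemma tube_map_derivative:
  "(tube_map T has_derivative (\<lambda>(\<sigma>, w). \<sigma> *\<^sub>R \<gamma>1 s + r *\<^sub>R w)) (at (s, v))"
proof -
  have "(\<gamma> has_derivative (\<lambda>\<sigma>. \<sigma> *\<^sub>R \<gamma>1 s)) (at (fst (s, v)))"
    using curve_vderiv by (simp add: has_vector_derivative_def)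
  then have "((\<lambda>p. \<gamma> (fst p)) has_derivative (\<lambda>d. fst d *\<^sub>R \<gamma>1 s)) (at (s, v))"
    by (rule has_derivative_compose[rotated]) (auto intro!: derivative_eq_intros)
  then have "((\<lambda>p. \<gamma> (fst p) + r *\<^sub>R snd p) has_derivative (\<lambda>d. fst d *\<^sub>R \<gamma>1 s + r *\<^sub>R snd d)) (at (s, v))"
    by (intro has_derivative_add) (auto intro!: derivative_eq_intros)
  then show ?thesis
    by (simp add: tube_map_def case_prod_unfold)
qed

lemma frechet_tube_map:
  "frechet_derivative (tube_map T) (at (s, v)) = (\<lambda>(\<sigma>, w). \<sigma> *\<^sub>R \<gamma>1 s + r *\<^sub>R w)"
  using frechet_derivative_at[OF tube_map_derivative] by simp

lemma frechet_tube_normal: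
  "frechet_derivative tube_normal (at p) = (\<lambda>(\<sigma>, w). - w)"
proof -
  have "((\<lambda>p. - snd p) has_derivative (\<lambda>d. - snd d)) (at p)" for p :: "real \<times> (real^3)"
    by (auto intro!: derivative_eq_intros)
  then have "(tube_normal has_derivative (\<lambda>(\<sigma>, w). - w)) (at p)"
    by (simp add: tube_normal_def case_prod_unfold)
  then show ?thesis
    using frechet_derivative_at by metis
qed

text \<open>Both equations come from differentiating the constraints
  \<open>v \<bullet> v = 1\<close> and \<open>v \<bullet> \<gamma>1 s = 0\<close> along a curve in
  the bundle.\<close>

lemma tangent_space_normal_bundle_imp:
  assumes "(\<sigma>, w) \<in> tangent_space (normal_bundle T) (s, v)"
  shows "w \<bullet> v = 0" "w \<bullet> \<gamma>1 s = - \<sigma> * (v \<bullet> \<gamma>2 s)"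
proof -
  obtain c where c: "c 0 = (s, v)" "\<forall>\<^sub>F t in nhds 0. c t \<in> normal_bundle T"
    and dc: "(c has_vector_derivative (\<sigma>, w)) (at 0)"
    using assms by (auto simp: tangent_space_def)
  have d1: "((\<lambda>t. fst (c t)) has_vector_derivative \<sigma>) (at 0)"
    using bounded_linear.has_vector_derivative[OF bounded_linear_fst dc] by simp
  have d2: "((\<lambda>t. snd (c t)) has_vector_derivative w) (at 0)"
    using bounded_linear.has_vector_derivative[OF bounded_linear_snd dc] by simp
  \<comment> \<open>The curve stays in the bundle only for parameters near 0, so the constraints are
    constant only eventually; that is enough for the derivative at 0.\<close>
  have const: "D = 0"
    if "(h has_vector_derivative D) (at 0)" "\<forall>\<^sub>F t in nhds 0. h t = k" for h :: "real \<Rightarrow> real" and D k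
  proof -
    have "((\<lambda>_. k) has_vector_derivative D) (at 0)"
      using that has_vector_derivative_cong_ev[of UNIV h "\<lambda>_. k" 0]
      by (metis (mono_tags, lifting) eventually_mono eventually_nhds_x_imp_x)
    then show ?thesis
      using vector_derivative_unique_at[OF _ has_vector_derivative_const] by blast
  qed
  have "snd (c 0) \<bullet> w + w \<bullet> snd (c 0) = 0"
  proof (rule const)
    show "((\<lambda>t. snd (c t) \<bullet> snd (c t)) has_vector_derivative snd (c 0) \<bullet> w + w \<bullet> snd (c 0)) (at 0)"
      using bounded_bilinear.has_vector_derivative[OF bounded_bilinear_inner d2 d2] .
    show "\<forall>\<^sub>F t in nhds 0. snd (c t) \<bullet> snd (c t) = 1"
      using c(2) by eventually_elim (auto simp: normal_bundle_def dot_square_norm)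
  qed
  then show "w \<bullet> v = 0"
    using c(1) by (simp add: inner_commute)
  have d3: "((\<lambda>t. \<gamma>1 (fst (c t))) has_vector_derivative \<sigma> *\<^sub>R \<gamma>2 s) (at 0)"
    using vector_diff_chain_at[OF d1, of \<gamma>1 "\<gamma>2 s"] tangent_vderiv c(1) by (simp add: o_def)
  have "snd (c 0) \<bullet> (\<sigma> *\<^sub>R \<gamma>2 s) + w \<bullet> \<gamma>1 (fst (c 0)) = 0"
  proof (rule const)
    show "((\<lambda>t. snd (c t) \<bullet> \<gamma>1 (fst (c t))) has_vector_derivative
        snd (c 0) \<bullet> (\<sigma> *\<^sub>R \<gamma>2 s) + w \<bullet> \<gamma>1 (fst (c 0))) (at 0)"
      using bounded_bilinear.has_vector_derivative[OF bounded_bilinear_inner d2 d3] .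
    show "\<forall>\<^sub>F t in nhds 0. snd (c t) \<bullet> \<gamma>1 (fst (c t)) = 0"
      using c(2) by eventually_elim (auto simp: normal_bundle_def)
  qed
  then show "w \<bullet> \<gamma>1 s = - \<sigma> * (v \<bullet> \<gamma>2 s)"
    using c(1) by simp
qed

context
  fixes v :: "real^3"
  assumes v: "norm v = 1" "v \<bullet> \<gamma>1 s = 0"
begin

text \<open>Keep \<open>s\<close> fixed and rotate \<open>v\<close> in its normal plane, in the
  orthonormal basis \<open>v\<close>, \<open>cross3 v (\<gamma>1 s)\<close>.\<close>

lemma circle_direction_in_tangent_space:
  "(0, cross3 v (\<gamma>1 s)) \<in> tangent_space (normal_bundle T) (s, v)"
proof -
  define b where "b = cross3 v (\<gamma>1 s)"
  have b: "b \<bullet> b = 1" "b \<bullet> v = 0" "b \<bullet> \<gamma>1 s = 0" "v \<bullet> v = 1"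
    using norm_cross3_orthonormal[OF v(1) norm_tangent[OF s] v(2)] v
    by (auto simp: b_def dot_square_norm dot_cross_self)
  define c where "c = (\<lambda>t::real. (s, cos t *\<^sub>R v + sin t *\<^sub>R b))"
  have "c t \<in> normal_bundle T" for t
  proof -
    have "(cos t *\<^sub>R v + sin t *\<^sub>R b) \<bullet> (cos t *\<^sub>R v + sin t *\<^sub>R b) = cos t * cos t + sin t * sin t"
      using b by (simp add: inner_simps inner_commute)
    then have "norm (cos t *\<^sub>R v + sin t *\<^sub>R b) = 1"
      by (simp add: norm_eq_1 flip: power2_eq_square)
    moreover have "(cos t *\<^sub>R v + sin t *\<^sub>R b) \<bullet> \<gamma>1 s = 0"
      using b v by (simp add: inner_simps)
    ultimately show ?thesis
      using s by (simp add: c_def normal_bundle_def)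
  qed
  moreover have "(c has_vector_derivative (0, b)) (at 0)"
    unfolding c_def
    by (auto intro!: derivative_eq_intros has_vector_derivative_Pair)
  moreover have "c 0 = (s, v)"
    by (simp add: c_def)
  ultimately show ?thesis
    unfolding tangent_space_def b_def by (auto intro!: exI[of _ c])
qed

text \<open>The curve is obtained by projecting \<open>v\<close> to the normal planes and normalizing.\<close>

lemma axial_direction_in_tangent_space:
  "(1, - (v \<bullet> \<gamma>2 s) *\<^sub>R \<gamma>1 s) \<in> tangent_space (normal_bundle T) (s, v)"
proof -
  define u where "u = (\<lambda>t. v - (v \<bullet> \<gamma>1 (s + t)) *\<^sub>R \<gamma>1 (s + t))"
  define c where "c = (\<lambda>t. (s + t, (1 / norm (u t)) *\<^sub>R u t))"
  have u0: "u 0 = v"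
    using v by (simp add: u_def)
  have dg: "((\<lambda>t. \<gamma>1 (s + t)) has_vector_derivative \<gamma>2 s) (at 0)"
  proof -
    have "((\<lambda>t. s + t) has_vector_derivative 1) (at 0)"
      by (auto intro!: derivative_eq_intros)
    from vector_diff_chain_at[OF this, of \<gamma>1 "\<gamma>2 s"] show ?thesis
      using tangent_vderiv by (simp add: o_def)
  qed
  have di: "((\<lambda>t. v \<bullet> \<gamma>1 (s + t)) has_real_derivative v \<bullet> \<gamma>2 s) (at 0)"
    using bounded_linear.has_vector_derivative[OF bounded_linear_inner_right dg]
    by (simp add: has_real_derivative_iff_has_vector_derivative)
  \<comment> \<open>The other term of the product rule,
    \<open>(v \<bullet> \<gamma>1 s) *\<^sub>R \<gamma>2 s\<close>, vanishes because
    \<open>v\<close> is normal to the curve.\<close>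
  have du: "(u has_vector_derivative - (v \<bullet> \<gamma>2 s) *\<^sub>R \<gamma>1 s) (at 0)"
    unfolding u_def
    using has_vector_derivative_diff[OF has_vector_derivative_const[of v] has_vector_derivative_scaleR[OF di dg]] v
    by simp
  \<comment> \<open>The velocity of \<open>u\<close> at 0 is a multiple of
    \<open>\<gamma>1 s\<close>, hence orthogonal to \<open>v = u 0\<close>. So the norm of
    \<open>u\<close> is stationary at 0, and normalizing does not change the velocity.\<close>
  have "(norm has_derivative (\<lambda>y. y \<bullet> sgn v)) (at (u 0))"
    using has_derivative_norm[of v] u0 v(1) by (metis norm_zero zero_neq_one)
  then have "((\<lambda>t. norm (u t)) has_vector_derivative (- (v \<bullet> \<gamma>2 s) *\<^sub>R \<gamma>1 s) \<bullet> sgn v) (at 0)"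
    using vector_derivative_diff_chain_within[OF du has_derivative_at_withinI]
    by (fastforce simp: o_def)
  then have dn: "((\<lambda>t. norm (u t)) has_real_derivative 0) (at 0)"
    using v by (simp add: has_real_derivative_iff_has_vector_derivative sgn_div_norm inner_commute)
  have "((\<lambda>t. 1 / norm (u t)) has_real_derivative 0) (at 0)"
    by (rule derivative_eq_intros dn refl | use u0 v in force)+
  from has_vector_derivative_scaleR[OF this du]
  have "((\<lambda>t. (1 / norm (u t)) *\<^sub>R u t) has_vector_derivative - (v \<bullet> \<gamma>2 s) *\<^sub>R \<gamma>1 s) (at 0)"
    using u0 v by simp
  then have dc: "(c has_vector_derivative (1, - (v \<bullet> \<gamma>2 s) *\<^sub>R \<gamma>1 s)) (at 0)"
    unfolding c_def
    by (intro has_vector_derivative_Pair) (auto intro!: derivative_eq_intros)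
  have "continuous (at 0) u"
    using du has_vector_derivative_continuous by blast
  then have "(u \<longlongrightarrow> v) (nhds 0)"
    using u0 by (metis continuous_at tendsto_at_iff_tendsto_nhds)
  then have "\<forall>\<^sub>F t in nhds 0. u t \<noteq> 0"
    using v(1) by (intro tendsto_imp_eventually_ne) auto
  moreover have "\<forall>\<^sub>F t in nhds 0. s + t \<in> interval T"
  proof -
    have "((\<lambda>t. s + t) \<longlongrightarrow> s + 0) (nhds 0)"
      by (intro tendsto_intros filterlim_ident)
    then have "filterlim (\<lambda>t. s + t) (nhds s) (nhds 0)"
      by simp
    with eventually_interval show ?thesis
      by (rule eventually_compose_filterlim)
  qed
  ultimately have "\<forall>\<^sub>F t in nhds 0. c t \<in> normal_bundle T"
  proof eventually_elim
    case (elim t)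
    then have "u t \<bullet> \<gamma>1 (s + t) = 0"
      using norm_tangent[of "s + t"] by (simp add: u_def inner_simps dot_square_norm)
    with elim show ?case
      by (simp add: c_def normal_bundle_def)
  qed
  moreover have "c 0 = (s, v)"
    using u0 v by (simp add: c_def)
  ultimately show ?thesis
    using dc unfolding tangent_space_def by blast
qed

section \<open>Principal curvatures of the tube and the values of \<open>K\<close> and
  \<open>H\<close>\<close>

lemma regular_nonzero: "1 - r * (v \<bullet> \<gamma>2 s) \<noteq> 0"
proof (cases "curvature T s = 0")
  case True
  then show ?thesis by (simp add: curvature_def)
next
  case False
  then have pos: "curvature T s > 0"
    by (simp add: curvature_def)
  \<comment> \<open>By Cauchy-Schwarz the component of the acceleration along \<open>v\<close> is
    the curvature times a cosine, the form in which regularity is assumed.\<close>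
  have "\<bar>v \<bullet> \<gamma>2 s\<bar> \<le> curvature T s"
    using Cauchy_Schwarz_ineq2[of v "\<gamma>2 s"] v by (simp add: curvature_def)
  then have "cos (arccos ((v \<bullet> \<gamma>2 s) / curvature T s)) = (v \<bullet> \<gamma>2 s) / curvature T s"
    using pos by (intro cos_arccos) (auto simp: field_simps abs_le_iff)
  then have "v \<bullet> \<gamma>2 s = curvature T s * cos (arccos ((v \<bullet> \<gamma>2 s) / curvature T s))"
    using pos by simp
  moreover have "\<forall>t. 1 - r * curvature T s * cos t \<noteq> 0"
    using reg s by (simp add: regular_tubular_def)
  ultimately show ?thesis
    by (metis mult.assoc)
qed

private abbreviation (input) "k0 \<equiv> - (v \<bullet> \<gamma>2 s) / (1 - r * (v \<bullet> \<gamma>2 s))"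

text \<open>Since the normal is \<open>-v\<close>, the map \<open>- dN\<close> sends
  \<open>(\<sigma>, w)\<close> to \<open>w\<close>. With \<open>c = v \<bullet> \<gamma>2 s\<close>,
  the axial direction has \<open>w = - c *\<^sub>R \<gamma>1 s\<close> and image
  \<open>(1 - r * c) *\<^sub>R \<gamma>1 s\<close>; the circle direction has
  \<open>w = cross3 v (\<gamma>1 s)\<close> and image \<open>r *\<^sub>R w\<close>. The images are
  orthogonal, and nonzero by regularity.\<close>

lemma principal_curvatures_tube:
  "principal_curvatures (normal_bundle T) (tube_map T) tube_normal (s, v) k0 (1 / r)"
proof -
  define e b where "e = \<gamma>1 s" and "b = cross3 v e"
  define c where "c = v \<bullet> \<gamma>2 s"
  have ne: "1 - r * c \<noteq> 0" "r > 0"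
    using regular_nonzero radius_pos by (auto simp: c_def)
  have ob: "norm e = 1" "norm b = 1" "e \<bullet> b = 0"
    using norm_cross3_orthonormal[OF v(1) norm_tangent[OF s] v(2)] norm_tangent[OF s]
    by (auto simp: e_def b_def dot_cross_self)
  have e1: "1 *\<^sub>R e + r *\<^sub>R (- c *\<^sub>R e) = (1 - r * c) *\<^sub>R e"
    by (simp add: algebra_simps)
  have inner0: "((1 - r * c) *\<^sub>R e) \<bullet> (r *\<^sub>R b) = 0"
    using ob by simp
  have nz: "(1 - r * c) *\<^sub>R e \<noteq> 0" "r *\<^sub>R b \<noteq> 0"
    using ob ne by auto
  have neq: "(1 - r * c) *\<^sub>R e \<noteq> r *\<^sub>R b"
    using inner0 nz by (metis inner_eq_zero_iff)
  have ind: "independent {(1 - r * c) *\<^sub>R e, r *\<^sub>R b}"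
    using inner0 nz
    by (intro pairwise_orthogonal_independent)
       (auto simp: pairwise_def orthogonal_def inner_commute)
  show ?thesis
    unfolding principal_curvatures_def Let_def frechet_tube_map frechet_tube_normal
  proof (rule bexI, rule bexI, intro conjI)
    let ?df = "\<lambda>(\<sigma>, w). \<sigma> *\<^sub>R \<gamma>1 s + r *\<^sub>R w"
    have df: "?df (1, - c *\<^sub>R e) = (1 - r * c) *\<^sub>R e" "?df (0, b) = r *\<^sub>R b"
      using e1 by (simp_all add: e_def)
    show "?df (1, - c *\<^sub>R e) \<noteq> ?df (0, b)" "independent {?df (1, - c *\<^sub>R e), ?df (0, b)}"
      unfolding df using neq ind by auto
    show "- (\<lambda>(\<sigma>, w). - w) (1::real, - c *\<^sub>R e) = k0 *\<^sub>R ?df (1, - c *\<^sub>R e)"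
      unfolding df using ne by (simp add: c_def)
    show "- (\<lambda>(\<sigma>, w). - w) (0::real, b) = (1 / r) *\<^sub>R ?df (0, b)"
      unfolding df using ne by simp
    show "(0, b) \<in> tangent_space (normal_bundle T) (s, v)"
      using circle_direction_in_tangent_space by (simp add: b_def e_def)
    show "(1, - c *\<^sub>R e) \<in> tangent_space (normal_bundle T) (s, v)"
      using axial_direction_in_tangent_space by (simp add: c_def e_def)
  qed
qed

text \<open>The eigenvalue equation reads \<open>(1 - k * r) *\<^sub>R w = (k * \<sigma>) *\<^sub>R
  \<gamma>1 s\<close>. If \<open>k * r = 1\<close>, then \<open>\<sigma> = 0\<close> and
  \<open>w\<close> is orthogonal to \<open>v\<close> and the tangent. Otherwise \<open>w\<close> is
  a multiple of the tangent, and the tangency constraint determines \<open>k\<close>.\<close>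

lemma principal_direction_tube:
  assumes d: "(\<sigma>, w) \<in> tangent_space (normal_bundle T) (s, v)"
    and eig: "w = k *\<^sub>R (\<sigma> *\<^sub>R \<gamma>1 s + r *\<^sub>R w)"
    and nz: "\<sigma> *\<^sub>R \<gamma>1 s + r *\<^sub>R w \<noteq> 0"
  shows "k = 1 / r \<and> (\<exists>a. \<sigma> *\<^sub>R \<gamma>1 s + r *\<^sub>R w = a *\<^sub>R cross3 v (\<gamma>1 s)) \<or>
    k = k0 \<and> (\<exists>a. \<sigma> *\<^sub>R \<gamma>1 s + r *\<^sub>R w = a *\<^sub>R \<gamma>1 s)"
proof -
  define e c where "e = \<gamma>1 s" and "c = v \<bullet> \<gamma>2 s"
  have w: "w \<bullet> v = 0" "w \<bullet> e = - \<sigma> * c"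
    using tangent_space_normal_bundle_imp[OF d] by (auto simp: e_def c_def)
  have ne: "1 - r * c \<noteq> 0" "r > 0"
    using regular_nonzero radius_pos by (auto simp: c_def)
  have ne1: "norm e = 1"
    using norm_tangent[OF s] by (simp add: e_def)
  then have ee: "e \<bullet> e = 1"
    by (simp add: dot_square_norm)
  have eq: "(1 - k * r) *\<^sub>R w = (k * \<sigma>) *\<^sub>R e"
    using eig by (simp add: algebra_simps e_def)
  show ?thesis
  proof (cases "k * r = 1")
    case True
    then have "k \<noteq> 0" by auto
    have "(k * \<sigma>) *\<^sub>R e = 0"
      using eq True by simp
    with \<open>k \<noteq> 0\<close> have "\<sigma> = 0"
      using ne1 by auto
    then have "w = (w \<bullet> cross3 v e) *\<^sub>R cross3 v e"
      using w v ne1 by (intro orthogonal_to_pair_collinear) (auto simp: e_def)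
    then have "\<sigma> *\<^sub>R e + r *\<^sub>R w = (r * (w \<bullet> cross3 v e)) *\<^sub>R cross3 v e"
      using \<open>\<sigma> = 0\<close> by (metis add_0 scaleR_scaleR scaleR_zero_left)
    moreover have "k = 1 / r"
      using True ne by (simp add: field_simps)
    ultimately show ?thesis
      by (auto simp: e_def)
  next
    case False
    have "w = (1 / (1 - k * r)) *\<^sub>R ((1 - k * r) *\<^sub>R w)"
      using False by simp
    also have "\<dots> = (k * \<sigma> / (1 - k * r)) *\<^sub>R e"
      by (simp add: eq)
    finally have we: "w = (k * \<sigma> / (1 - k * r)) *\<^sub>R e" .
    have "\<sigma> \<noteq> 0"
      using nz we by auto
    have "(1 - k * r) * (w \<bullet> e) = k * \<sigma>"
      using arg_cong[OF eq, of "\<lambda>x. x \<bullet> e"] ee by simp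
    \<comment> \<open>Here \<open>w \<bullet> e\<close> is replaced by
      \<open>- \<sigma> * c\<close>; cancelling \<open>\<sigma>\<close> leaves a linear equation for
      \<open>k\<close>.\<close>
    then have "\<sigma> * (- c * (1 - k * r) - k) = 0"
      by (simp add: w algebra_simps)
    then have "- c * (1 - k * r) - k = 0"
      using \<open>\<sigma> \<noteq> 0\<close> by (metis mult_eq_0_iff)
    then have "- c = k * (1 - r * c)"
      by (simp add: algebra_simps)
    then have "k = - c / (1 - r * c)"
      using ne by (simp add: field_simps)
    moreover have "\<sigma> *\<^sub>R e + r *\<^sub>R w = (\<sigma> + r * (k * \<sigma> / (1 - k * r))) *\<^sub>R e"
      by (subst we) (simp add: algebra_simps)
    ultimately show ?thesis
      unfolding e_def c_def by blast
  qed
qed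

text \<open>Each eigenvector falls under one alternative of \<open>principal_direction_tube\<close>.
  Since every alternative fixes the line of the image vector, independence forbids both from falling
  under the same one.\<close>

lemma principal_curvatures_tube_unique:
  assumes "principal_curvatures (normal_bundle T) (tube_map T) tube_normal (s, v) k1 k2"
  shows "k1 = k0 \<and> k2 = 1 / r \<or> k1 = 1 / r \<and> k2 = k0"
proof -
  let ?df = "\<lambda>(\<sigma>, w). \<sigma> *\<^sub>R \<gamma>1 s + r *\<^sub>R w"
  let ?dN = "\<lambda>(\<sigma>, w). - w"
  have "\<exists>d1 \<in> tangent_space (normal_bundle T) (s, v). \<exists>d2 \<in> tangent_space (normal_bundle T) (s, v).
      ?df d1 \<noteq> ?df d2 \<and> independent {?df d1, ?df d2} \<and>
      - ?dN d1 = k1 *\<^sub>R ?df d1 \<and> - ?dN d2 = k2 *\<^sub>R ?df d2"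
    using assms
    unfolding principal_curvatures_def Let_def frechet_tube_map frechet_tube_normal .
  then obtain d1 d2 where d':
    "d1 \<in> tangent_space (normal_bundle T) (s, v)" "d2 \<in> tangent_space (normal_bundle T) (s, v)"
    and x': "?df d1 \<noteq> ?df d2" "independent {?df d1, ?df d2}"
      "- ?dN d1 = k1 *\<^sub>R ?df d1" "- ?dN d2 = k2 *\<^sub>R ?df d2"
    by blast
  obtain \<sigma>1 w1 \<sigma>2 w2 where eq: "d1 = (\<sigma>1, w1)" "d2 = (\<sigma>2, w2)"
    by (cases d1, cases d2)
  note d = d'[unfolded eq]
  define x1 x2 where "x1 = \<sigma>1 *\<^sub>R \<gamma>1 s + r *\<^sub>R w1" and "x2 = \<sigma>2 *\<^sub>R \<gamma>1 s + r *\<^sub>R w2"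
  have x: "x1 \<noteq> x2" "independent {x1, x2}" "w1 = k1 *\<^sub>R x1" "w2 = k2 *\<^sub>R x2"
    using x' unfolding eq x1_def x2_def prod.case minus_minus .
  have nz: "x1 \<noteq> 0" "x2 \<noteq> 0"
    using x(2) dependent_zero by auto
  define par where "par x u \<longleftrightarrow> (\<exists>a. x = a *\<^sub>R u)" for x u :: "real^3"
  have not_both: "\<not> (par x1 u \<and> par x2 u)" for u
    unfolding par_def using not_independent_collinear x(1,2) by metis
  note direction = principal_direction_tube[folded par_def]
  have "k1 = 1 / r \<and> par x1 (cross3 v (\<gamma>1 s)) \<or> k1 = k0 \<and> par x1 (\<gamma>1 s)"
    by (rule direction[OF d(1), folded x1_def, OF x(3) nz(1)])
  moreover have "k2 = 1 / r \<and> par x2 (cross3 v (\<gamma>1 s)) \<or> k2 = k0 \<and> par x2 (\<gamma>1 s)"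
    by (rule direction[OF d(2), folded x2_def, OF x(4) nz(2)])
  ultimately show ?thesis
    using not_both[of "cross3 v (\<gamma>1 s)"] not_both[of "\<gamma>1 s"] by satx
qed

text \<open>Product and sum ignore the order of the pair; this is the uniqueness that the definite
  descriptions of \<open>K\<close> and \<open>H\<close> require.\<close>

lemma principal_curvatures_tube_symmetric:
  assumes "principal_curvatures (normal_bundle T) (tube_map T) tube_normal (s, v) k1 k2"
  shows "k1 * k2 = k0 * (1 / r)" "k1 + k2 = k0 + 1 / r"
proof -
  have "a * b = c * d \<and> a + b = c + d" if "a = c \<and> b = d \<or> a = d \<and> b = c" for a b c d :: real
    using that by auto
  from this[OF principal_curvatures_tube_unique[OF assms]]
  show "k1 * k2 = k0 * (1 / r)" "k1 + k2 = k0 + 1 / r"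
    by blast+
qed

lemma tube_K_eq: "tube_K T (s, v) = k0 * (1 / r)"
  unfolding tube_K_def gaussian_curvature_def
proof (rule the_equality)
  show "\<exists>k1 k2. principal_curvatures (normal_bundle T) (tube_map T) tube_normal (s, v) k1 k2 \<and>
      k0 * (1 / r) = k1 * k2"
    by (rule exI[of _ k0], rule exI[of _ "1 / r"]) (intro conjI refl principal_curvatures_tube)
  show "K = k0 * (1 / r)"
    if "\<exists>k1 k2. principal_curvatures (normal_bundle T) (tube_map T) tube_normal (s, v) k1 k2 \<and> K = k1 * k2" for K
    using that principal_curvatures_tube_symmetric(1) by metis
qed

lemma tube_H_eq: "tube_H T (s, v) = (k0 + 1 / r) / 2"
  unfolding tube_H_def mean_curvature_def
proof (rule the_equality)
  show "\<exists>k1 k2. principal_curvatures (normal_bundle T) (tube_map T) tube_normal (s, v) k1 k2 \<and>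
      (k0 + 1 / r) / 2 = (k1 + k2) / 2"
    by (rule exI[of _ k0], rule exI[of _ "1 / r"]) (intro conjI refl principal_curvatures_tube)
  show "H = (k0 + 1 / r) / 2"
    if "\<exists>k1 k2. principal_curvatures (normal_bundle T) (tube_map T) tube_normal (s, v) k1 k2 \<and> H = (k1 + k2) / 2" for H
    using that principal_curvatures_tube_symmetric(2) by metis
qed

text \<open>One principal curvature is always \<open>1 / r\<close>; eliminating the other gives the
  line \<open>r\<^sup>2 x - 2 r y + 1 = 0\<close> solved for \<open>y\<close>.\<close>

lemma tube_H_eq_tube_K: "tube_H T (s, v) = 1 / (2 * r) + r / 2 * tube_K T (s, v)"
proof -
  have "(k + 1 / r) / 2 = 1 / (2 * r) + r / 2 * (k * (1 / r))" for k
    using radius_pos by (simp add: field_simps)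
  then show ?thesis
    unfolding tube_K_eq tube_H_eq .
qed

end

text \<open>The value \<open>x = 0\<close> yields a point with \<open>K = 0\<close> on every tube;
  the whole range of \<open>x\<close> yields infinitely many values of \<open>K\<close> where the
  curve bends.\<close>

lemma exists_normal_with_component:
  assumes "\<bar>x\<bar> \<le> curvature T s"
  obtains v where "norm v = 1" "v \<bullet> \<gamma>1 s = 0" "v \<bullet> \<gamma>2 s = x"
proof (cases "curvature T s = 0")
  case True
  obtain y :: "real^3" where y: "y \<noteq> 0" "orthogonal (\<gamma>1 s) y"
    by (rule orthogonal_to_vector_exists[of "\<gamma>1 s"]) (simp_all)
  have "norm (sgn y) = 1" "sgn y \<bullet> \<gamma>1 s = 0" "sgn y \<bullet> \<gamma>2 s = x"
    using y True assms by (simp_all add: norm_sgn curvature_def orthogonal_def inner_commute sgn_div_norm)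
  then show ?thesis
    by (rule that)
next
  case False
  define \<kappa> where "\<kappa> = curvature T s"
  define n where "n = (1 / \<kappa>) *\<^sub>R \<gamma>2 s"
  define b where "b = cross3 n (\<gamma>1 s)"
  define a where "a = x / \<kappa>"
  have \<kappa>: "\<kappa> > 0" "norm (\<gamma>2 s) = \<kappa>" "\<bar>x\<bar> \<le> \<kappa>"
    using False assms by (auto simp: \<kappa>_def curvature_def)
  have n: "norm n = 1" "n \<bullet> \<gamma>1 s = 0" "\<gamma>2 s = \<kappa> *\<^sub>R n"
    using \<kappa> tangent_orthogonal_acceleration by (auto simp: n_def inner_commute)
  have b: "b \<bullet> b = 1" "b \<bullet> n = 0" "b \<bullet> \<gamma>1 s = 0" "n \<bullet> n = 1"
    using norm_cross3_orthonormal[OF n(1) norm_tangent[OF s] n(2)] n(1)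
    by (auto simp: b_def dot_square_norm dot_cross_self)
  have a: "a\<^sup>2 \<le> 1"
    using \<kappa> by (simp add: a_def abs_square_le_1)
  \<comment> \<open>In the orthonormal basis \<open>n\<close>, \<open>b\<close> of the normal plane,
    this is a unit vector whose angle with the principal normal \<open>n\<close> has cosine
    \<open>a\<close>.\<close>
  define v where "v = a *\<^sub>R n + sqrt (1 - a\<^sup>2) *\<^sub>R b"
  have "v \<bullet> v = a * a + sqrt (1 - a\<^sup>2) * sqrt (1 - a\<^sup>2)"
    using b by (simp add: v_def inner_simps inner_commute)
  then have "norm v = 1"
    using a by (simp add: norm_eq_1 power2_eq_square)
  moreover have "v \<bullet> \<gamma>1 s = 0"
    using b n by (simp add: v_def inner_simps)
  moreover have "v \<bullet> \<gamma>2 s = x"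
    using b n(3) \<kappa> by (simp add: v_def inner_simps a_def)
  ultimately show ?thesis
    using that by blast
qed

lemma infinite_range_tube_K:
  assumes "curvature T s \<noteq> 0"
  shows "infinite ((\<lambda>v. tube_K T (s, v)) ` {v. norm v = 1 \<and> v \<bullet> \<gamma>1 s = 0})"
proof
  let ?V = "{v. norm v = 1 \<and> v \<bullet> \<gamma>1 s = 0}"
  let ?K = "\<lambda>v. tube_K T (s, v)"
  assume "finite (?K ` ?V)"
  \<comment> \<open>This map recovers \<open>x = v \<bullet> \<gamma>2 s\<close> from
    \<open>K = - x / (1 - r * x) / r\<close>, so its image of the values of \<open>K\<close>
    contains a nondegenerate interval.\<close>
  then have "finite ((\<lambda>k. r * k / (r\<^sup>2 * k - 1)) ` ?K ` ?V)"
    by (rule finite_imageI)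
  moreover have "{- curvature T s .. curvature T s} \<subseteq> (\<lambda>k. r * k / (r\<^sup>2 * k - 1)) ` ?K ` ?V"
  proof
    fix x assume "x \<in> {- curvature T s .. curvature T s}"
    then obtain v where v: "norm v = 1" "v \<bullet> \<gamma>1 s = 0" "v \<bullet> \<gamma>2 s = x"
      using exists_normal_with_component[of x] by (auto simp: abs_le_iff)
    have ne: "1 - r * x \<noteq> 0" "r > 0"
      using regular_nonzero[OF v(1,2)] radius_pos v(3) by auto
    have K: "?K v = - x / (1 - r * x) / r"
      using tube_K_eq[OF v(1,2)] v(3) by simp
    then have rK: "r * ?K v = - x / (1 - r * x)"
      using ne by simp
    have "r\<^sup>2 * ?K v - 1 = r * (- x / (1 - r * x)) - 1"
      unfolding rK[symmetric] by (simp add: power2_eq_square)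
    also have "\<dots> = - 1 / (1 - r * x)"
      using ne by (simp add: divide_simps)
    finally have "r\<^sup>2 * ?K v - 1 = - 1 / (1 - r * x)" .
    with rK have "x = r * ?K v / (r\<^sup>2 * ?K v - 1)"
      using ne by simp
    then show "x \<in> (\<lambda>k. r * k / (r\<^sup>2 * k - 1)) ` ?K ` ?V"
      using v by blast
  qed
  moreover have "infinite {- curvature T s .. curvature T s}"
    using assms by (simp add: infinite_Icc_iff curvature_def)
  ultimately show False
    using finite_subset by blast
qed

end

section \<open>Polynomials vanishing on a line\<close>

text \<open>As \<open>y\<close> is the outer variable, \<open>poly Q g\<close> is the substitution
  \<open>y = g(x)\<close>, which restricts \<open>Q\<close> to the graph of
  \<open>g\<close>.\<close>

lemma eval2_graph: "eval2 Q a (poly g a) = poly (poly Q g) a"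
  unfolding eval2_def by (induction Q) simp_all

text \<open>Up to the unit \<open>- 2 * r\<close>, the generator is monic and linear in
  \<open>y\<close>, so the factor theorem over \<open>\<real>[x]\<close> applies.\<close>

lemma line_polynomial_eq:
  assumes "r \<noteq> 0"
  shows "var_x * const2 (r\<^sup>2) - const2 (2 * r) * var_y + 1 = const2 (- 2 * r) * [:- [:1 / (2 * r), r / 2:], 1:]"
  using assms
  by (simp add: var_x_def var_y_def const2_def power2_eq_square one_pCons)

text \<open>The restriction of \<open>Q\<close> to the line is a polynomial in \<open>x\<close> with
  infinitely many roots, hence zero. So \<open>g\<close> is a root of \<open>Q\<close> over
  \<open>\<real>[x]\<close>, and \<open>y - g\<close> divides \<open>Q\<close>.\<close>

lemma in_principal_ideal_if_infinite_zeros: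
  assumes "r \<noteq> 0" and "infinite A" and zero: "\<And>a. a \<in> A \<Longrightarrow> eval2 Q a (1 / (2 * r) + r / 2 * a) = 0"
  shows "Q \<in> principal_ideal (var_x * const2 (r\<^sup>2) - const2 (2 * r) * var_y + 1)"
proof -
  define g where "g = [:1 / (2 * r), r / 2:]"
  have "poly (poly Q g) a = 0" if "a \<in> A" for a
    using zero[OF that] eval2_graph[of Q a g] by (simp add: g_def mult.commute)
  then have "poly Q g = 0"
    using \<open>infinite A\<close> poly_roots_finite[of "poly Q g"] finite_subset[of A "{a. poly (poly Q g) a = 0}"]
    by blast
  then obtain P where P: "Q = [:- g, 1:] * P"
    by (auto simp: poly_eq_0_iff_dvd dvd_def)
  have "const2 (- 1 / (2 * r)) * const2 (- 2 * r) = 1"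
    using \<open>r \<noteq> 0\<close> by (simp add: const2_def one_pCons)
  then have "Q = (const2 (- 1 / (2 * r)) * const2 (- 2 * r)) * ([:- g, 1:] * P)"
    using P by (simp only: mult_1)
  then have "Q = (P * const2 (- 1 / (2 * r))) * (const2 (- 2 * r) * [:- g, 1:])"
    by (simp only: ac_simps)
  then show ?thesis
    unfolding principal_ideal_def line_polynomial_eq[OF \<open>r \<noteq> 0\<close>] g_def by blast
qed

section \<open>The two inclusions of the classification\<close>

lemma tube_in_S_E_cases:
  assumes T: "T \<in> S_E Q"
  shows "radius T \<in> Rad_E Q" "right_cylinder T \<or> radius T \<in> Rad_E_star Q"
proof -
  have reg: "regular_tubular T"
    and zero: "\<And>p. p \<in> normal_bundle T \<Longrightarrow> eval2 Q (tube_K T p) (tube_H T p) = 0"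
    using T by (auto simp: S_E_def)
  have "\<exists>s. s \<in> interval T"
    using reg einterval_nonempty[of "lower T" "upper T"]
    by (auto simp: regular_tubular_def tubular_def interval_def)
  then obtain s where s: "s \<in> interval T" ..
  \<comment> \<open>Some unit normal is orthogonal to the acceleration, even where the curve bends;
    there \<open>(K, H)\<close> is the point that a cylinder of the same radius has.\<close>
  have "\<bar>0\<bar> \<le> curvature T s"
    by (simp add: curvature_def)
  from exists_normal_with_component[OF reg s this]
  obtain v where v: "norm v = 1" "v \<bullet> vderiv (curve T) s = 0" "v \<bullet> vderiv (vderiv (curve T)) s = 0" .
  have K0: "tube_K T (s, v) = 0"
    using tube_K_eq[OF reg s v(1,2)] v(3) by simp
  then have "tube_H T (s, v) = 1 / (2 * radius T)"
    using tube_H_eq_tube_K[OF reg s v(1,2)] by simp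
  then show rad: "radius T \<in> Rad_E Q"
    using zero[of "(s, v)"] K0 s v radius_pos[OF reg s] by (simp add: Rad_E_def normal_bundle_def)
  show "right_cylinder T \<or> radius T \<in> Rad_E_star Q"
  proof (cases "\<forall>s\<in>interval T. curvature T s = 0")
    case True
    then show ?thesis
      using reg by (simp add: right_cylinder_def)
  next
    case False
    then obtain q where q: "q \<in> interval T" "curvature T q \<noteq> 0"
      by blast
    \<comment> \<open>The single normal circle over \<open>q\<close> already supplies infinitely
      many zeros of \<open>Q\<close> on the line.\<close>
    have "Q \<in> principal_ideal (var_x * const2 ((radius T)\<^sup>2) - const2 (2 * radius T) * var_y + 1)"
    proof (rule in_principal_ideal_if_infinite_zeros)
      show "radius T \<noteq> 0"
        using radius_pos[OF reg q(1)] by simp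
      show "infinite ((\<lambda>v. tube_K T (q, v)) ` {v. norm v = 1 \<and> v \<bullet> vderiv (curve T) q = 0})"
        using infinite_range_tube_K[OF reg q] .
    next
      fix a assume "a \<in> (\<lambda>v. tube_K T (q, v)) ` {v. norm v = 1 \<and> v \<bullet> vderiv (curve T) q = 0}"
      then obtain v where v: "norm v = 1" "v \<bullet> vderiv (curve T) q = 0" and a: "a = tube_K T (q, v)"
        by blast
      show "eval2 Q a (1 / (2 * radius T) + radius T / 2 * a) = 0"
        using zero[of "(q, v)"] tube_H_eq_tube_K[OF reg q(1) v] q(1) v a
        by (simp add: normal_bundle_def)
    qed
    then show ?thesis
      using rad by (simp add: Rad_E_star_def)
  qed
qed

theorem theorem1:
  fixes Q :: "real poly poly"
  shows "S_E Q =
    {T. right_cylinder T \<and> radius T \<in> Rad_E Q} \<union>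
    {T. regular_tubular T \<and> radius T \<in> Rad_E_star Q}"
proof (intro equalityI subsetI)
  fix T assume T: "T \<in> S_E Q"
  then have "regular_tubular T"
    by (simp add: S_E_def)
  then show "T \<in> {T. right_cylinder T \<and> radius T \<in> Rad_E Q} \<union>
      {T. regular_tubular T \<and> radius T \<in> Rad_E_star Q}"
    using tube_in_S_E_cases[OF T] by blast
next
  fix T assume T: "T \<in> {T. right_cylinder T \<and> radius T \<in> Rad_E Q} \<union>
      {T. regular_tubular T \<and> radius T \<in> Rad_E_star Q}"
  then have reg: "regular_tubular T"
    by (auto simp: right_cylinder_def)
  have "eval2 Q (tube_K T (s, v)) (tube_H T (s, v)) = 0" if "(s, v) \<in> normal_bundle T" for s v
  proof -
    have s: "s \<in> interval T" and v: "norm v = 1" "v \<bullet> vderiv (curve T) s = 0"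
      using that by (auto simp: normal_bundle_def)
    note H = tube_H_eq_tube_K[OF reg s v]
    have pos: "radius T > 0"
      using radius_pos[OF reg s] .
    from T show ?thesis
    proof
      assume "T \<in> {T. right_cylinder T \<and> radius T \<in> Rad_E Q}"
      then have "vderiv (vderiv (curve T)) s = 0" and Q: "eval2 Q 0 (1 / (2 * radius T)) = 0"
        using s by (auto simp: right_cylinder_def curvature_def Rad_E_def)
      then have "tube_K T (s, v) = 0"
        using tube_K_eq[OF reg s v] by simp
      then show ?thesis
        using Q unfolding H by simp
    next
      assume "T \<in> {T. regular_tubular T \<and> radius T \<in> Rad_E_star Q}"
      then obtain P where Q: "Q = P * (var_x * const2 ((radius T)\<^sup>2) - const2 (2 * radius T) * var_y + 1)"
        by (auto simp: Rad_E_star_def principal_ideal_def)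
      \<comment> \<open>The generator vanishes on the whole line, whatever the value
        \<open>k\<close> of \<open>K\<close>, so every multiple of it vanishes at
        \<open>(K, H)\<close>.\<close>
      have "k * (radius T)\<^sup>2 - 2 * radius T * (1 / (2 * radius T) + radius T / 2 * k) + 1 = 0" for k
        using pos by (simp add: field_simps power2_eq_square)
      then show ?thesis
        unfolding Q H by (simp only: eval2_simps mult_zero_right)
    qed
  qed
  then show "T \<in> S_E Q"
    using reg by (auto simp: S_E_def)
qed

end
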